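(* Let $\mathcal{B}=(e_n)_{n=1}^\infty$ be a basis of a Banach space $\mathbb{X}$ and let $\omega$ be a weight on subsets of $\mathbb{N}$. (1) If $\mathcal{B}$ is $C$-$\omega$-greedy, then $\mathcal{B}$ is $C$-suppression unconditional and satisfies $C$-$\omega$-Property (A). (2) If $\mathcal{B}$ is $K$-suppression unconditional and satisfies $C$-$\omega$-Property (A), then $\mathcal{B}$ is $KC$-$\omega$-greedy.
   Context: $\mathbb{X}$ is a Banach space over $\mathbb{K}=\mathbb{R}$ or $\mathbb{C}$. A basis of $\mathbb{X}$ means a semi-normalized Schauder basis $(e_n)_{n=1}^\infty$, i.e. $0<\inf_n\|e_n\|\le\sup_n\|e_n\|<\infty$, with biorthogonal functionals $(e_n^* )_{n=1}^\infty\subset\mathbb{X}^*$. $\mathbb{N}^{<\infty}$ is the set of finite subsets of $\mathbb{N}$. A weight on sets is a function $\omega:\mathcal{P}(\mathbb{N})\to[0,\infty]$, whose value at $A$ is written $w(A)$, such that $w(\emptyset)=0$ and $w(A)\in(0,\infty]$ for every nonempty $A\subset\mathbb{N}$. Greedy sets: for $x\in\mathbb{X}$, $m\in\mathbb{N}$, a greedy set of order $m$ of $x$ is a set $\Lambda_m(x)\subset\mathbb{N}$ with $|\Lambda_m(x)|=m$ and $\min_{n\in\Lambda_m(x)}|e_n^*(x)|\ge\max_{n\notin\Lambda_m(x)}|e_n^*(x)|$; the corresponding greedy sum is $G_m(x)=\sum_{n\in\Lambda_m(x)}e_n^*(x)e_n$. $\mathcal{B}$ is $C$-$\omega$-greedy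 ($C\ge1$) if for all $x\in\mathbb{X}$, $m\in\mathbb{N}$ and all greedy sets $\Lambda_m(x)$, $\|x-G_m(x)\|\le C\sigma^\omega_{\Lambda_m(x)}(x)$, where for $B\subset\mathbb{N}$ $$\sigma^\omega_B(x)=\inf\Big\{\Big\|x-\sum_{n\in A}a_ne_n\Big\|: A\in\mathbb{N}^{<\infty},\ w(A\setminus B)\le w(B\setminus A),\ a_n\in\mathbb{K}\Big\}.$$ $\mathcal{B}$ is $K$-suppression unconditional ($K\ge 1$) if $\|P_A(x)\|\le K\|x\|$ for all $x\in\mathbb{X}$ and all $A\subset\mathbb{N}$, where $P_A(x)=\sum_{n\in A}e_n^*(x)e_n$. Signs: $\varepsilon=(\varepsilon_n)_{n=1}^\infty\subset\mathbb{K}$ with $|\varepsilon_n|=1$; $1_{\varepsilon A}=\sum_{n\in A}\varepsilon_ne_n$. $\operatorname{supp}(x)=\{n:e_n^*(x)\ne0\}$, $\|x\|_\infty=\sup_n|e_n^*(x)|$. $\mathcal{B}$ satisfies $C$-$\omega$-Property (A) ($C\ge1$) if $\|x+1_{\varepsilon A}\|\le C\|x+1_{\delta B}\|$ for all $A,B\in\mathbb{N}^{<\infty}$ with $w(A)\le w(B)$, all signs $\varepsilon,\delta$, and all $x\in\mathbb{X}$ with $\|x\|_\infty\le1$ such that $A$, $B$, $\operatorname{supp}(x)$ are pairwise disjoint. *)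

theory Defs
  imports "HOL-Analysis.Analysis"
begin

(* A Banach space over K = R or C. The scalars are an arbitrary type of class real_normed_field;
   by the Gelfand-Mazur theorem its only instances, up to isometric isomorphism, are the real and
   the complex numbers. The class banach supplies the norm, its completeness and the underlying
   real vector space; the last axiom makes that real structure the restriction of smul. *)
locale banach_space_over = vector_space smul
  for smul :: "'k::real_normed_field \<Rightarrow> 'x::banach \<Rightarrow> 'x" +
  assumes norm_smul: "norm (smul a x) = norm a * norm x"
    and smul_of_real: "smul (of_real r) x = r *\<^sub>R x"

definition schauder_basis :: "('k::real_normed_field \<Rightarrow> 'x::banach \<Rightarrow> 'x) \<Rightarrow> (nat \<Rightarrow> 'x) \<Rightarrow> bool" where
  "schauder_basis smul e \<longleftrightarrow> (\<forall>x. \<exists>!a :: nat \<Rightarrow> 'k. (\<lambda>n. smul (a n) (e n)) sums x)"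

(* The biorthogonal functional e_n^* evaluated at x. For a Schauder basis of a Banach space it is
   automatically linear and continuous. *)
definition coord :: "('k::real_normed_field \<Rightarrow> 'x::banach \<Rightarrow> 'x) \<Rightarrow> (nat \<Rightarrow> 'x) \<Rightarrow> nat \<Rightarrow> 'x \<Rightarrow> 'k" where
  "coord smul e n x = (THE a :: nat \<Rightarrow> 'k. (\<lambda>k. smul (a k) (e k)) sums x) n"

definition semi_normalized_basis ::
    "('k::real_normed_field \<Rightarrow> 'x::banach \<Rightarrow> 'x) \<Rightarrow> (nat \<Rightarrow> 'x) \<Rightarrow> bool" where
  "semi_normalized_basis smul e \<longleftrightarrow> schauder_basis smul e \<and>
     0 < (INF n. norm (e n)) \<and> bdd_above (range (\<lambda>n. norm (e n)))"

definition set_weight :: "(nat set \<Rightarrow> ennreal) \<Rightarrow> bool" where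
  "set_weight w \<longleftrightarrow> w {} = 0 \<and> (\<forall>A. A \<noteq> {} \<longrightarrow> 0 < w A)"

(* min over L >= max over the complement, written out pairwise. *)
definition greedy_set ::
    "('k::real_normed_field \<Rightarrow> 'x::banach \<Rightarrow> 'x) \<Rightarrow> (nat \<Rightarrow> 'x) \<Rightarrow> 'x \<Rightarrow> nat \<Rightarrow> nat set \<Rightarrow> bool" where
  "greedy_set smul e x m L \<longleftrightarrow> finite L \<and> card L = m \<and>
     (\<forall>n\<in>L. \<forall>k. k \<notin> L \<longrightarrow> norm (coord smul e k x) \<le> norm (coord smul e n x))"

definition greedy_sum ::
    "('k::real_normed_field \<Rightarrow> 'x::banach \<Rightarrow> 'x) \<Rightarrow> (nat \<Rightarrow> 'x) \<Rightarrow> nat set \<Rightarrow> 'x \<Rightarrow> 'x" where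
  "greedy_sum smul e L x = (\<Sum>n\<in>L. smul (coord smul e n x) (e n))"

definition sigma_weight ::
    "('k::real_normed_field \<Rightarrow> 'x::banach \<Rightarrow> 'x) \<Rightarrow> (nat \<Rightarrow> 'x) \<Rightarrow> (nat set \<Rightarrow> ennreal)
      \<Rightarrow> nat set \<Rightarrow> 'x \<Rightarrow> real" where
  "sigma_weight smul e w B x =
     Inf {norm (x - (\<Sum>n\<in>A. smul (a n) (e n))) | A (a :: nat \<Rightarrow> 'k).
            finite A \<and> w (A - B) \<le> w (B - A)}"

(* Basis vectors are indexed from 0, but the order m of a greedy set is at least 1. *)
definition weight_greedy ::
    "('k::real_normed_field \<Rightarrow> 'x::banach \<Rightarrow> 'x) \<Rightarrow> (nat \<Rightarrow> 'x) \<Rightarrow> (nat set \<Rightarrow> ennreal) \<Rightarrow> real \<Rightarrow> bool" where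
  "weight_greedy smul e w C \<longleftrightarrow> 1 \<le> C \<and>
     (\<forall>x. \<forall>m\<ge>1. \<forall>L. greedy_set smul e x m L \<longrightarrow>
        norm (x - greedy_sum smul e L x) \<le> C * sigma_weight smul e w L x)"

(* P_A x for an arbitrary, possibly infinite A; the series is taken in the order of the basis. *)
definition proj_series ::
    "('k::real_normed_field \<Rightarrow> 'x::banach \<Rightarrow> 'x) \<Rightarrow> (nat \<Rightarrow> 'x) \<Rightarrow> nat set \<Rightarrow> 'x \<Rightarrow> nat \<Rightarrow> 'x" where
  "proj_series smul e A x n = (if n \<in> A then smul (coord smul e n x) (e n) else 0)"

definition proj ::
    "('k::real_normed_field \<Rightarrow> 'x::banach \<Rightarrow> 'x) \<Rightarrow> (nat \<Rightarrow> 'x) \<Rightarrow> nat set \<Rightarrow> 'x \<Rightarrow> 'x" where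
  "proj smul e A x = (\<Sum>n. proj_series smul e A x n)"

(* Summability expresses that P_A x is well defined (suminf is a junk value otherwise). *)
definition suppression_unconditional ::
    "('k::real_normed_field \<Rightarrow> 'x::banach \<Rightarrow> 'x) \<Rightarrow> (nat \<Rightarrow> 'x) \<Rightarrow> real \<Rightarrow> bool" where
  "suppression_unconditional smul e K \<longleftrightarrow> 1 \<le> K \<and>
     (\<forall>x A. summable (proj_series smul e A x) \<and> norm (proj smul e A x) \<le> K * norm x)"

definition sign_seq :: "(nat \<Rightarrow> 'k::real_normed_field) \<Rightarrow> bool" where
  "sign_seq \<epsilon> \<longleftrightarrow> (\<forall>n. norm (\<epsilon> n) = 1)"

definition sign_sum ::
    "('k::real_normed_field \<Rightarrow> 'x::banach \<Rightarrow> 'x) \<Rightarrow> (nat \<Rightarrow> 'x) \<Rightarrow> (nat \<Rightarrow> 'k) \<Rightarrow> nat set \<Rightarrow> 'x" where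
  "sign_sum smul e \<epsilon> A = (\<Sum>n\<in>A. smul (\<epsilon> n) (e n))"

definition supp :: "('k::real_normed_field \<Rightarrow> 'x::banach \<Rightarrow> 'x) \<Rightarrow> (nat \<Rightarrow> 'x) \<Rightarrow> 'x \<Rightarrow> nat set" where
  "supp smul e x = {n. coord smul e n x \<noteq> 0}"

(* The supremum is finite for a semi-normalized basis, since the coordinates of x tend to 0. *)
definition coord_sup_norm :: "('k::real_normed_field \<Rightarrow> 'x::banach \<Rightarrow> 'x) \<Rightarrow> (nat \<Rightarrow> 'x) \<Rightarrow> 'x \<Rightarrow> real" where
  "coord_sup_norm smul e x = (SUP n. norm (coord smul e n x))"

definition weight_property_A ::
    "('k::real_normed_field \<Rightarrow> 'x::banach \<Rightarrow> 'x) \<Rightarrow> (nat \<Rightarrow> 'x) \<Rightarrow> (nat set \<Rightarrow> ennreal) \<Rightarrow> real \<Rightarrow> bool" where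
  "weight_property_A smul e w C \<longleftrightarrow> 1 \<le> C \<and>
     (\<forall>A B \<epsilon> \<delta> x. finite A \<and> finite B \<and> w A \<le> w B \<and> sign_seq \<epsilon> \<and> sign_seq \<delta> \<and>
        coord_sup_norm smul e x \<le> 1 \<and>
        A \<inter> B = {} \<and> A \<inter> supp smul e x = {} \<and> B \<inter> supp smul e x = {} \<longrightarrow>
        norm (x + sign_sum smul e \<epsilon> A) \<le> C * norm (x + sign_sum smul e \<delta> B))"

end

theory Submission
  imports Defs
begin

text \<open>Both parts of the greedy conclusion come from adding or removing a finite block of
  coefficients. If the coefficients of \<open>x\<close> on a finite set \<open>B\<close> are made huge, then \<open>B\<close>
  becomes a greedy set and the greedy inequality bounds \<open>x - P\<^sub>B x\<close>; if unit blocks on \<open>A\<close> and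
  \<open>B\<close> are added to \<open>x\<close>, then \<open>B\<close> is greedy and one gets Property (A).

  Conversely let \<open>L\<close> be greedy for \<open>x\<close>, let \<open>t\<close> be the least modulus of a coefficient on \<open>L\<close>, and
  let \<open>z\<close> be \<open>x\<close> minus a combination of the \<open>e\<^sub>n\<close> with \<open>n \<in> A\<close>. The coefficients of \<open>x\<close>
  on \<open>A - L\<close> have modulus at most \<open>t\<close>, so by convexity they may be replaced by coefficients of modulus
  exactly \<open>t\<close>. Property (A) moves this block to \<open>L - A\<close>, with the signs of \<open>x\<close>. The resulting vector
  arises from \<open>z\<close> by multiplying its coefficients by numbers in \<open>[0,1]\<close>, hence is in a convex
  hull of projections of \<open>z\<close>; this is why the constant \<open>K\<close> enters only once.\<close>

section \<open>Convexity: reducing norm bounds to extreme coefficients\<close>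

lemma norm_add_sum_convex_hull_le:
  fixes v :: "'b::real_normed_vector" and S :: "'a \<Rightarrow> 'b set"
  assumes "finite F" and "\<And>n. n \<in> F \<Longrightarrow> g n \<in> convex hull (S n)"
    and "\<And>f. (\<And>n. n \<in> F \<Longrightarrow> f n \<in> S n) \<Longrightarrow> norm (v + sum f F) \<le> M"
  shows "norm (v + sum g F) \<le> M"
  using assms
proof (induction F arbitrary: v rule: finite_induct)
  case empty
  then show ?case by simp
next
  case (insert n F)
  \<comment> \<open>With \<open>g\<close> fixed on \<open>F\<close>, the bound says that the
    \<open>n\<close>-th summand lies in a closed ball. Balls are convex, so points of
    \<open>S n\<close> suffice; such a point is absorbed into \<open>v\<close>, over which the
    induction is general.\<close>
  have "y \<in> cball (- (v + sum g F)) M" if y: "y \<in> S n" for y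
  proof -
    have "norm ((v + y) + sum g F) \<le> M"
    proof (rule insert.IH)
      fix f assume f: "\<And>n. n \<in> F \<Longrightarrow> f n \<in> S n"
      have "norm (v + sum (f(n := y)) (insert n F)) \<le> M"
        by (rule insert.prems(2)) (use f y in auto)
      moreover have "sum (f(n := y)) F = sum f F"
        using insert.hyps by (intro sum.cong) auto
      ultimately show "norm (v + y + sum f F) \<le> M"
        using insert.hyps by (simp add: add.assoc)
    qed (use insert.prems in auto)
    moreover have "dist (- (v + sum g F)) y = norm ((v + y) + sum g F)"
      unfolding dist_norm by (subst norm_minus_cancel[symmetric]) (simp add: algebra_simps)
    ultimately show ?thesis by simp
  qed
  then have "convex hull (S n) \<subseteq> cball (- (v + sum g F)) M"
    by (intro hull_minimal) auto
  with insert.prems(1)[of n] have "dist (- (v + sum g F)) (g n) \<le> M"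
    by auto
  moreover have "dist (- (v + sum g F)) (g n) = norm (v + sum g (insert n F))"
  proof -
    have "- (v + sum g F) - g n = - (v + sum g (insert n F))"
      using insert.hyps by simp
    then show ?thesis
      by (simp only: dist_norm norm_minus_cancel)
  qed
  ultimately show ?case by simp
qed

text \<open>The real line through 0 and \<open>c\<close> meets the sphere in two antipodal points,
  and \<open>c\<close> lies on the segment between them. For \<open>c = 0\<close> any direction
  serves, and \<open>\<eta>\<close> is set to 1.\<close>

lemma in_convex_hull_sphere:
  fixes c :: "'a::real_normed_field"
  assumes "norm c \<le> t"
  shows "c \<in> convex hull (sphere 0 t)"
proof (cases "t = 0")
  case True
  then show ?thesis using assms by (auto intro: hull_inc)
next
  case False
  with assms have t: "t > 0" using norm_ge_zero[of c] by linarith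
  define \<eta> where "\<eta> = (if c = 0 then 1 else sgn c)"
  have \<eta>: "norm \<eta> = 1" by (simp add: \<eta>_def norm_sgn)
  have c: "c = norm c *\<^sub>R \<eta>"
    by (simp add: \<eta>_def sgn_div_norm)
  \<comment> \<open>The solution of \<open>(2 * u - 1) * t = norm c\<close>.\<close>
  define u where "u = (1 + norm c / t) / 2"
  have u: "0 \<le> u" "u \<le> 1" using t assms by (auto simp: u_def field_simps)
  have "(1 - u) *\<^sub>R (- (t *\<^sub>R \<eta>)) + u *\<^sub>R (t *\<^sub>R \<eta>) = ((2 * u - 1) * t) *\<^sub>R \<eta>"
    by (simp add: algebra_simps flip: scaleR_add_left scaleR_2)
  also have "(2 * u - 1) * t = norm c" using t by (simp add: u_def field_simps)
  finally have "c \<in> closed_segment (- (t *\<^sub>R \<eta>)) (t *\<^sub>R \<eta>)"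
    using u c unfolding in_segment by metis
  moreover have "convex hull {- (t *\<^sub>R \<eta>), t *\<^sub>R \<eta>} \<subseteq> convex hull (sphere 0 t)"
    using \<eta> t by (intro hull_mono) auto
  ultimately show ?thesis unfolding segment_convex_hull by blast
qed

lemma scaleR_in_convex_hull_zero:
  fixes u :: "'a::real_vector"
  assumes "0 \<le> r" "r \<le> 1"
  shows "r *\<^sub>R u \<in> convex hull {0, u}"
  using assms by (auto simp: in_segment simp flip: segment_convex_hull)

section \<open>Coordinates with respect to the basis\<close>

locale semi_normalized_basis_over = banach_space_over smul
  for smul :: "'k::real_normed_field \<Rightarrow> 'x::banach \<Rightarrow> 'x" +
  fixes e :: "nat \<Rightarrow> 'x"
  assumes semi_normalized: "semi_normalized_basis smul e"
begin

abbreviation cf :: "nat \<Rightarrow> 'x \<Rightarrow> 'k" where "cf \<equiv> coord smul e"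

lemma smul_scaleR_left: "smul (r *\<^sub>R a) x = r *\<^sub>R smul a x"
  by (metis smul_of_real scale_scale scaleR_conv_of_real)

lemma linear_smul_left: "linear (\<lambda>a. smul a x)"
  by (rule linearI) (simp_all add: scale_left_distrib smul_scaleR_left)

lemma ex1_expansion: "\<exists>!a. (\<lambda>n. smul (a n) (e n)) sums x"
  using semi_normalized by (auto simp: semi_normalized_basis_def schauder_basis_def)

lemma sums_coord: "(\<lambda>n. smul (cf n x) (e n)) sums x"
  unfolding coord_def by (rule theI'[OF ex1_expansion])

text \<open>Uniqueness of the expansion: coordinates are computed below by exhibiting a convergent
  series.\<close>

lemma coord_eqI: "(\<lambda>n. smul (a n) (e n)) sums x \<Longrightarrow> cf k x = a k"
  using ex1_expansion[of x] sums_coord[of x] by metis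

lemma coord_add: "cf k (x + y) = cf k x + cf k y"
  by (rule coord_eqI)
    (use sums_add[OF sums_coord[of x] sums_coord[of y]] in \<open>simp add: scale_left_distrib\<close>)

lemma coord_diff: "cf k (x - y) = cf k x - cf k y"
  by (rule coord_eqI)
    (use sums_diff[OF sums_coord[of x] sums_coord[of y]] in \<open>simp add: scale_left_diff_distrib\<close>)

lemma coord_scaleR: "cf k (r *\<^sub>R x) = r *\<^sub>R cf k x"
  by (rule coord_eqI)
    (use sums_scaleR_right[OF sums_coord[of x]] in \<open>simp add: smul_scaleR_left\<close>)

lemma coord_sum:
  assumes "finite A"
  shows "cf k (\<Sum>n\<in>A. smul (a n) (e n)) = (if k \<in> A then a k else 0)"
proof (rule coord_eqI[where a = "\<lambda>k. if k \<in> A then a k else 0"])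
  have "(\<lambda>n. if n \<in> A then smul (a n) (e n) else 0) sums (\<Sum>n\<in>A. smul (a n) (e n))"
    by (rule sums_If_finite_set[OF assms])
  then show "(\<lambda>n. smul (if n \<in> A then a n else 0) (e n)) sums (\<Sum>n\<in>A. smul (a n) (e n))"
    by (rule sums_cong[THEN iffD1, rotated]) simp
qed

lemma coord_ext: "(\<And>k. cf k x = cf k y) \<Longrightarrow> x = y"
  using sums_coord[of x] sums_coord[of y] by (simp add: sums_unique2)

text \<open>The terms of the expansion tend to 0, hence are bounded, and the norms of the
  \<open>e n\<close> are bounded away from 0.\<close>

lemma bounded_coord: "\<exists>b. \<forall>n. norm (cf n x) \<le> b"
proof -
  define i where "i = (INF n. norm (e n))"
  have i: "0 < i" using semi_normalized by (simp add: semi_normalized_basis_def i_def)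
  have ile: "i \<le> norm (e n)" for n
    unfolding i_def by (rule cINF_lower) (auto intro: bdd_belowI[of _ 0])
  have "(\<lambda>n. smul (cf n x) (e n)) \<longlonglongrightarrow> 0"
    by (rule summable_LIMSEQ_zero[OF sums_summable[OF sums_coord]])
  then have "Bseq (\<lambda>n. smul (cf n x) (e n))"
    by (intro convergent_imp_Bseq convergentI)
  then obtain b where b: "\<And>n. norm (smul (cf n x) (e n)) \<le> b"
    unfolding Bseq_def by blast
  have "norm (cf n x) \<le> b / i" for n
  proof -
    have "norm (cf n x) * i \<le> norm (cf n x) * norm (e n)"
      by (rule mult_left_mono[OF ile]) simp
    also have "\<dots> \<le> b" using b[of n] by (simp add: norm_smul)
    finally show ?thesis using i by (simp add: field_simps)
  qed
  then show ?thesis by blast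
qed

lemma coord_sup_norm_le_iff: "coord_sup_norm smul e x \<le> t \<longleftrightarrow> (\<forall>n. norm (cf n x) \<le> t)"
proof -
  have "bdd_above (range (\<lambda>n. norm (cf n x)))"
    using bounded_coord[of x] by (auto intro: bdd_aboveI)
  then show ?thesis unfolding coord_sup_norm_def by (simp add: cSUP_le_iff)
qed

lemma coord_greedy_sum:
  "finite L \<Longrightarrow> cf k (greedy_sum smul e L x) = (if k \<in> L then cf k x else 0)"
  unfolding greedy_sum_def by (rule coord_sum)

lemma coord_sign_sum:
  "finite A \<Longrightarrow> cf k (sign_sum smul e \<epsilon> A) = (if k \<in> A then \<epsilon> k else 0)"
  unfolding sign_sum_def by (rule coord_sum)

text \<open>Any vector with the right coordinates identifies the projection, also for infinite
  \<open>A\<close>: its own expansion is the projection series, which therefore converges.\<close>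

lemma proj_eqI:
  assumes "\<And>n. cf n y = (if n \<in> A then cf n x else 0)"
  shows "proj smul e A x = y"
proof -
  have "proj_series smul e A x sums y"
    by (rule sums_cong[THEN iffD1, OF _ sums_coord[of y]]) (simp add: proj_series_def assms)
  then show ?thesis unfolding proj_def by (simp add: sums_iff)
qed

section \<open>Consequences of the greedy inequality\<close>

lemma sigma_weight_le:
  assumes "finite A" "w (A - B) \<le> w (B - A)"
  shows "sigma_weight smul e w B x \<le> norm (x - (\<Sum>n\<in>A. smul (a n) (e n)))"
  unfolding sigma_weight_def
  by (rule cInf_lower) (use assms in \<open>auto intro: bdd_belowI[of _ 0]\<close>)

lemma weight_greedyD:
  assumes "weight_greedy smul e w C" and "finite L" "L \<noteq> {}"
    and "\<And>n k. n \<in> L \<Longrightarrow> k \<notin> L \<Longrightarrow> norm (cf k x) \<le> norm (cf n x)"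
    and "finite A" "w (A - L) \<le> w (L - A)"
  shows "norm (x - greedy_sum smul e L x) \<le> C * norm (x - (\<Sum>n\<in>A. smul (a n) (e n)))"
proof -
  have C: "1 \<le> C" using assms(1) by (simp add: weight_greedy_def)
  have "card L \<ge> 1" using assms(2,3) by (simp add: Suc_le_eq card_gt_0_iff)
  then have "norm (x - greedy_sum smul e L x) \<le> C * sigma_weight smul e w L x"
    using assms(1,2,4) unfolding weight_greedy_def greedy_set_def by blast
  also have "\<dots> \<le> C * norm (x - (\<Sum>n\<in>A. smul (a n) (e n)))"
    using C by (intro mult_left_mono sigma_weight_le assms) auto
  finally show ?thesis .
qed

lemma weight_greedy_imp_complement_bound:
  assumes "weight_greedy smul e w C" "finite B"
  shows "norm (x - greedy_sum smul e B x) \<le> C * norm x"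
proof (cases "B = {}")
  case True
  have "1 * norm x \<le> C * norm x"
    using assms(1) by (intro mult_right_mono) (auto simp: weight_greedy_def)
  then show ?thesis using True by (simp add: greedy_sum_def)
next
  case False
  obtain b where b: "\<And>n. norm (cf n x) \<le> b" using bounded_coord by blast
  then have b0: "0 \<le> b" using norm_ge_zero order_trans by blast
  \<comment> \<open>On \<open>B\<close> the coefficients of \<open>x + u\<close> have modulus at
    least \<open>2 * b - b = b\<close>, which bounds those off \<open>B\<close>.\<close>
  define u where "u = (\<Sum>n\<in>B. smul (of_real (2 * b)) (e n))"
  have cu: "cf k u = (if k \<in> B then of_real (2 * b) else 0)" for k
    unfolding u_def by (rule coord_sum[OF assms(2)])
  \<comment> \<open>The competitor is \<open>u\<close> itself, supported on \<open>A = B\<close>: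
    both set differences are empty, so the weight condition is trivial.\<close>
  have "norm ((x + u) - greedy_sum smul e B (x + u)) \<le> C * norm ((x + u) - u)"
    unfolding u_def
  proof (rule weight_greedyD[OF assms False])
    fix n k assume nk: "n \<in> B" "k \<notin> B"
    have "norm (cf k (x + u)) \<le> b" using b[of k] nk by (simp add: coord_add cu)
    also have "b \<le> norm (of_real (2 * b) :: 'k) - norm (cf n x)"
      using b[of n] b0 by simp
    also have "\<dots> \<le> norm (cf n (x + u))"
      using nk norm_diff_ineq[of "of_real (2 * b)" "cf n x"]
      by (simp add: coord_add cu add.commute)
    finally show "norm (cf k (x + (\<Sum>n\<in>B. smul (of_real (2 * b)) (e n))))
        \<le> norm (cf n (x + (\<Sum>n\<in>B. smul (of_real (2 * b)) (e n))))"
      unfolding u_def .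
  qed (use assms in auto)
  moreover have "(x + u) - greedy_sum smul e B (x + u) = x - greedy_sum smul e B x"
    by (rule coord_ext) (simp add: coord_add coord_diff coord_greedy_sum assms cu)
  ultimately show ?thesis by simp
qed

text \<open>Removing \<open>F - A\<close> from a block of the expansion leaves its part on
  \<open>A\<close>. Blocks far out yield the Cauchy criterion for the projection series, initial
  blocks the norm bound in the limit.\<close>

lemma weight_greedy_imp_finite_projection_bound:
  assumes "weight_greedy smul e w C" "finite F"
  shows "norm (\<Sum>n\<in>F \<inter> A. smul (cf n x) (e n)) \<le> C * norm (\<Sum>n\<in>F. smul (cf n x) (e n))"
    (is "norm ?p \<le> C * norm ?s")
proof -
  have "?s - greedy_sum smul e (F - A) ?s = ?p"
    by (rule coord_ext) (use assms in \<open>auto simp: coord_diff coord_greedy_sum coord_sum\<close>)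
  moreover have "norm (?s - greedy_sum smul e (F - A) ?s) \<le> C * norm ?s"
    by (rule weight_greedy_imp_complement_bound[OF assms(1)]) (use assms in auto)
  ultimately show ?thesis by simp
qed

lemma sum_proj_series:
  "finite F \<Longrightarrow> sum (proj_series smul e A x) F = (\<Sum>n\<in>F \<inter> A. smul (cf n x) (e n))"
  by (simp add: proj_series_def sum.inter_restrict)

lemma weight_greedy_imp_suppression_unconditional:
  assumes "weight_greedy smul e w C"
  shows "suppression_unconditional smul e C"
  unfolding suppression_unconditional_def
proof (intro conjI allI)
  show C: "1 \<le> C" using assms by (simp add: weight_greedy_def)
  fix x A
  have le: "norm (sum (proj_series smul e A x) F) \<le> C * norm (\<Sum>n\<in>F. smul (cf n x) (e n))"
    if "finite F" for F
    using weight_greedy_imp_finite_projection_bound[OF assms that] that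
    by (simp add: sum_proj_series)
  show sm: "summable (proj_series smul e A x)"
    unfolding summable_Cauchy
  proof (intro allI impI)
    fix d :: real assume "d > 0"
    then have "d / C > 0" using C by simp
    moreover have "summable (\<lambda>n. smul (cf n x) (e n))" using sums_coord by (rule sums_summable)
    ultimately obtain N where N: "\<And>m n. m \<ge> N \<Longrightarrow> norm (\<Sum>n\<in>{m..<n}. smul (cf n x) (e n)) < d / C"
      unfolding summable_Cauchy by blast
    have "norm (sum (proj_series smul e A x) {m..<n}) < d" if "m \<ge> N" for m n
    proof -
      have "norm (sum (proj_series smul e A x) {m..<n})
          \<le> C * norm (\<Sum>n\<in>{m..<n}. smul (cf n x) (e n))" by (rule le) simp
      also have "\<dots> < d" using N[OF that, of n] C by (simp add: field_simps)
      finally show ?thesis .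
    qed
    then show "\<exists>N. \<forall>m\<ge>N. \<forall>n. norm (sum (proj_series smul e A x) {m..<n}) < d" by blast
  qed
  have "(\<lambda>n. norm (sum (proj_series smul e A x) {..<n})) \<longlonglongrightarrow> norm (proj smul e A x)"
    unfolding proj_def by (intro tendsto_norm summable_LIMSEQ sm)
  moreover have "(\<lambda>n. C * norm (\<Sum>k<n. smul (cf k x) (e k))) \<longlonglongrightarrow> C * norm x"
    using sums_coord[of x] unfolding sums_def by (intro tendsto_intros)
  ultimately show "norm (proj smul e A x) \<le> C * norm x"
    by (rule LIMSEQ_le) (use le in blast)
qed

lemma weight_greedy_imp_property_A:
  assumes "weight_greedy smul e w C" and w: "set_weight w"
  shows "weight_property_A smul e w C"
  unfolding weight_property_A_def
proof (intro conjI allI impI; (elim conjE)?)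
  show C: "1 \<le> C" using assms(1) by (simp add: weight_greedy_def)
  fix A B and \<epsilon> \<delta> :: "nat \<Rightarrow> 'k" and x
  assume fin: "finite A" "finite B" and wAB: "w A \<le> w B" and sg: "sign_seq \<epsilon>" "sign_seq \<delta>"
    and x1: "coord_sup_norm smul e x \<le> 1"
    and disj: "A \<inter> B = {}" "A \<inter> supp smul e x = {}" "B \<inter> supp smul e x = {}"
  let ?a = "sign_sum smul e \<epsilon> A" and ?b = "sign_sum smul e \<delta> B"
  show "norm (x + ?a) \<le> C * norm (x + ?b)"
  proof (cases "B = {}")
    case True
    \<comment> \<open>Greedy sets of order 0 are excluded, so this case is separate; positivity of
      the weight on nonempty sets forces \<open>A\<close> to be empty too.\<close>
    with wAB w have "A = {}" unfolding set_weight_def by (metis leD)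
    with True have "norm (x + ?a) = 1 * norm (x + ?b)" by (simp add: sign_sum_def)
    also have "\<dots> \<le> C * norm (x + ?b)" using C by (intro mult_right_mono) auto
    finally show ?thesis .
  next
    case False
    have dx: "cf k x = 0" if "k \<in> A \<or> k \<in> B" for k
      using that disj by (auto simp: supp_def)
    have cx: "norm (cf k x) \<le> 1" for k using x1 by (simp add: coord_sup_norm_le_iff)
    \<comment> \<open>On \<open>B\<close> all coefficients of \<open>?y\<close> have modulus 1,
      elsewhere at most 1, so \<open>B\<close> is greedy. Removing \<open>B\<close> leaves
      \<open>x + ?a\<close>; the competitor on \<open>A\<close> leaves
      \<open>x + ?b\<close>.\<close>
    let ?y = "x + ?a + ?b"
    have cy: "cf k ?y = (if k \<in> A then \<epsilon> k else if k \<in> B then \<delta> k else cf k x)" for k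
      using dx disj(1) by (auto simp: coord_add coord_sign_sum fin)
    have "norm (?y - greedy_sum smul e B ?y) \<le> C * norm (?y - (\<Sum>n\<in>A. smul (\<epsilon> n) (e n)))"
    proof (rule weight_greedyD[OF assms(1) fin(2) False _ fin(1)])
      show "w (A - B) \<le> w (B - A)"
        using wAB disj(1) by (simp add: Diff_triv Int_commute)
      show "norm (cf k ?y) \<le> norm (cf n ?y)" if "n \<in> B" "k \<notin> B" for n k
        using that sg cx disj(1) unfolding cy sign_seq_def by auto
    qed
    moreover have "?y - greedy_sum smul e B ?y = x + ?a"
      by (rule coord_ext) (use fin dx disj(1) in
          \<open>auto simp: coord_diff coord_add coord_greedy_sum coord_sign_sum\<close>)
    moreover have "?y - (\<Sum>n\<in>A. smul (\<epsilon> n) (e n)) = x + ?b"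
      by (simp add: sign_sum_def)
    ultimately show ?thesis by simp
  qed
qed

section \<open>From unconditionality and Property (A) to the greedy inequality\<close>

lemma property_A_scaled:
  assumes "weight_property_A smul e w C" and "t > 0"
    and "finite A" "finite B" "w A \<le> w B" "sign_seq \<epsilon>" "sign_seq \<delta>"
    and "\<And>n. norm (cf n x) \<le> t"
    and "A \<inter> B = {}" "\<And>n. n \<in> A \<union> B \<Longrightarrow> cf n x = 0"
  shows "norm (x + t *\<^sub>R sign_sum smul e \<epsilon> A) \<le> C * norm (x + t *\<^sub>R sign_sum smul e \<delta> B)"
proof -
  \<comment> \<open>Homogeneity: dividing by \<open>t\<close> reduces to coordinates of modulus at
    most 1.\<close>
  let ?x = "(1 / t) *\<^sub>R x"
  have n: "norm (x + t *\<^sub>R y) = t * norm (?x + y)" for y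
  proof -
    have "x + t *\<^sub>R y = t *\<^sub>R (?x + y)" using assms(2) by (simp add: scaleR_add_right)
    then show ?thesis using assms(2) by simp
  qed
  have "coord_sup_norm smul e ?x \<le> 1"
    using assms(2,8) by (simp add: coord_sup_norm_le_iff coord_scaleR field_simps)
  moreover have "A \<inter> supp smul e ?x = {}" "B \<inter> supp smul e ?x = {}"
    using assms(10) by (auto simp: supp_def coord_scaleR)
  ultimately have "norm (?x + sign_sum smul e \<epsilon> A) \<le> C * norm (?x + sign_sum smul e \<delta> B)"
    using assms(1,3-7,9) unfolding weight_property_A_def by blast
  then show ?thesis using assms(2) by (simp add: n)
qed

text \<open>Each coefficient is a convex combination of scalars of modulus exactly \<open>t\<close>,
  that is, of \<open>t\<close> times signs, and \<open>a \<mapsto> smul a (e n)\<close> preserves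
  convex hulls.\<close>

lemma norm_le_of_sphere_coefficients:
  assumes "finite F" "t > 0" "\<And>n. n \<in> F \<Longrightarrow> norm (c n) \<le> t"
    and M: "\<And>\<epsilon>. sign_seq \<epsilon> \<Longrightarrow> norm (v + t *\<^sub>R sign_sum smul e \<epsilon> F) \<le> M"
  shows "norm (v + (\<Sum>n\<in>F. smul (c n) (e n))) \<le> M"
proof (rule norm_add_sum_convex_hull_le[OF assms(1), where S = "\<lambda>n. (\<lambda>a. smul a (e n)) ` sphere 0 t"])
  show "smul (c n) (e n) \<in> convex hull ((\<lambda>a. smul a (e n)) ` sphere 0 t)" if "n \<in> F" for n
    unfolding convex_hull_linear_image[OF linear_smul_left, symmetric]
    using in_convex_hull_sphere assms(3)[OF that] by blast
  fix f assume f: "\<And>n. n \<in> F \<Longrightarrow> f n \<in> (\<lambda>a. smul a (e n)) ` sphere 0 t"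
  have "\<exists>a. norm a = t \<and> f n = smul a (e n)" if "n \<in> F" for n
    using f[OF that] by auto
  then obtain a where a: "\<And>n. n \<in> F \<Longrightarrow> norm (a n) = t \<and> f n = smul (a n) (e n)" by metis
  \<comment> \<open>Off \<open>F\<close> the value 1 only completes the sign sequence.\<close>
  define \<epsilon> where "\<epsilon> n = (if n \<in> F then (1 / t) *\<^sub>R a n else 1)" for n
  have "sign_seq \<epsilon>" using a assms(2) by (simp add: sign_seq_def \<epsilon>_def)
  moreover have "t *\<^sub>R sign_sum smul e \<epsilon> F = sum f F"
    unfolding sign_sum_def scaleR_sum_right
    using a assms(2) by (intro sum.cong) (auto simp: \<epsilon>_def smul_scaleR_left)
  ultimately show "norm (v + sum f F) \<le> M" using M by metis
qed

lemma suppression_unconditional_property_A_imp_bound: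
  assumes su: "suppression_unconditional smul e K" and pA: "weight_property_A smul e w C"
    and L: "finite L" "L \<noteq> {}"
    and gr: "\<And>n k. n \<in> L \<Longrightarrow> k \<notin> L \<Longrightarrow> norm (cf k x) \<le> norm (cf n x)"
    and A: "finite A" "w (A - L) \<le> w (L - A)"
  shows "norm (x - greedy_sum smul e L x) \<le> K * C * norm (x - (\<Sum>n\<in>A. smul (a n) (e n)))"
proof -
  have K: "1 \<le> K" and C: "1 \<le> C"
    using su pA by (auto simp: suppression_unconditional_def weight_property_A_def)
  define z where "z = x - (\<Sum>n\<in>A. smul (a n) (e n))"
  have cz: "cf k z = cf k x" if "k \<notin> A" for k
    using that by (simp add: z_def coord_diff coord_sum A)
  define t where "t = Min ((\<lambda>n. norm (cf n x)) ` L)"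
  have tL: "t \<le> norm (cf n x)" if "n \<in> L" for n
    using that L by (simp add: t_def)
  have "t \<in> (\<lambda>n. norm (cf n x)) ` L"
    unfolding t_def using L by (intro Min_in) auto
  then obtain l where l: "l \<in> L" "t = norm (cf l x)" by blast
  have tk: "norm (cf k x) \<le> t" if "k \<notin> L" for k
    using gr l that by simp
  show ?thesis
  proof (cases "t = 0")
    case True
    \<comment> \<open>Here all coefficients of \<open>x\<close> off \<open>L\<close> vanish.\<close>
    have "x - greedy_sum smul e L x = 0"
    proof (rule coord_ext)
      show "cf k (x - greedy_sum smul e L x) = cf k 0" for k
        using tk[of k] True L coord_diff[of k x x] by (simp add: coord_diff coord_greedy_sum)
    qed
    then show ?thesis using K C by simp
  next
    case False
    then have t: "t > 0" using l by auto
    \<comment> \<open>The part shared by \<open>x\<close> and \<open>z\<close>, which agree off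
      \<open>A\<close>.\<close>
    define y where "y = x - greedy_sum smul e (A \<union> L) x"
    have cy: "cf k y = (if k \<in> A \<union> L then 0 else cf k x)" for k
      using A L by (simp add: y_def coord_diff coord_greedy_sum)
    define \<delta> where "\<delta> n = (if cf n x = 0 then 1 else sgn (cf n x))" for n
    have \<delta>: "sign_seq \<delta>" by (simp add: sign_seq_def \<delta>_def norm_sgn)
    have xy: "x - greedy_sum smul e L x = y + (\<Sum>n\<in>A - L. smul (cf n x) (e n))"
      by (rule coord_ext) (use A L in
          \<open>auto simp: coord_diff coord_add coord_greedy_sum coord_sum cy\<close>)
    \<comment> \<open>On \<open>L - A\<close> the coefficients of \<open>x\<close> have modulus at
      least \<open>t\<close>, so shrinking them to modulus \<open>t\<close> uses factors in
      \<open>[0,1]\<close>. The extreme cases keep or delete each term and are projections of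
      \<open>z\<close>.\<close>
    have *: "norm (y + t *\<^sub>R sign_sum smul e \<delta> (L - A)) \<le> K * norm z"
    proof -
      let ?u = "\<lambda>n. smul (cf n x) (e n)"
      have "norm (y + (\<Sum>n\<in>L - A. (t / norm (cf n x)) *\<^sub>R ?u n)) \<le> K * norm z"
      proof (rule norm_add_sum_convex_hull_le[where S = "\<lambda>n. {0, ?u n}"])
        show "(t / norm (cf n x)) *\<^sub>R ?u n \<in> convex hull {0, ?u n}" if "n \<in> L - A" for n
          using tL[of n] that t by (intro scaleR_in_convex_hull_zero) (auto simp: divide_le_eq)
        fix f assume f: "\<And>n. n \<in> L - A \<Longrightarrow> f n \<in> {0, ?u n}"
        define D where "D = {n \<in> L - A. f n = ?u n}"
        have D: "finite D" and DL: "D \<subseteq> L - A" using L by (auto simp: D_def)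
        have sD: "sum f (L - A) = sum ?u D"
          by (rule sum.mono_neutral_cong_right) (use L f in \<open>auto simp: D_def\<close>)
        have "proj smul e (D \<union> - (A \<union> L)) z = y + sum ?u D"
        proof (rule proj_eqI)
          show "cf n (y + sum ?u D) = (if n \<in> D \<union> - (A \<union> L) then cf n z else 0)" for n
            using DL by (auto simp: coord_add cy coord_sum[OF D] cz)
        qed
        moreover have "norm (proj smul e (D \<union> - (A \<union> L)) z) \<le> K * norm z"
          using su by (simp add: suppression_unconditional_def)
        ultimately show "norm (y + sum f (L - A)) \<le> K * norm z" by (simp add: sD)
      qed (use L in auto)
      also have "(\<Sum>n\<in>L - A. (t / norm (cf n x)) *\<^sub>R ?u n) = t *\<^sub>R sign_sum smul e \<delta> (L - A)"
        unfolding sign_sum_def scaleR_sum_right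
      proof (rule sum.cong)
        fix n assume "n \<in> L - A"
        then have "cf n x \<noteq> 0" using tL[of n] t by auto
        then show "(t / norm (cf n x)) *\<^sub>R ?u n = t *\<^sub>R smul (\<delta> n) (e n)"
          by (simp add: \<delta>_def sgn_div_norm smul_scaleR_left divide_inverse)
      qed simp
      finally show ?thesis .
    qed
    \<comment> \<open>Property (A) compares only blocks of constant modulus; convexity extends the
      bound to the coefficients of \<open>x\<close> on \<open>A - L\<close>, which have modulus at
      most \<open>t\<close>.\<close>
    have "norm (y + (\<Sum>n\<in>A - L. smul (cf n x) (e n))) \<le> C * (K * norm z)"
    proof (rule norm_le_of_sphere_coefficients[OF _ t])
      fix \<epsilon> :: "nat \<Rightarrow> 'k" assume \<epsilon>: "sign_seq \<epsilon>"
      have "norm (y + t *\<^sub>R sign_sum smul e \<epsilon> (A - L))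
          \<le> C * norm (y + t *\<^sub>R sign_sum smul e \<delta> (L - A))"
        by (rule property_A_scaled[OF pA t _ _ A(2) \<epsilon> \<delta>]) (use A L tk t cy in auto)
      also have "\<dots> \<le> C * (K * norm z)" using C * by (intro mult_left_mono) auto
      finally show "norm (y + t *\<^sub>R sign_sum smul e \<epsilon> (A - L)) \<le> C * (K * norm z)" .
    qed (use A tk in auto)
    then show ?thesis unfolding xy z_def[symmetric] by (simp add: mult_ac)
  qed
qed

lemma suppression_unconditional_property_A_imp_weight_greedy:
  assumes su: "suppression_unconditional smul e K" and pA: "weight_property_A smul e w C"
    and w: "set_weight w"
  shows "weight_greedy smul e w (K * C)"
  unfolding weight_greedy_def
proof (intro conjI allI impI)
  have K: "1 \<le> K" and C: "1 \<le> C"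
    using su pA by (auto simp: suppression_unconditional_def weight_property_A_def)
  show KC: "1 \<le> K * C" using mult_mono[OF K C] K by simp
  fix x m L assume m: "1 \<le> m" and g: "greedy_set smul e x m L"
  then have L: "finite L" "L \<noteq> {}" by (auto simp: greedy_set_def)
  let ?n = "norm (x - greedy_sum smul e L x)"
  have "?n / (K * C) \<le> sigma_weight smul e w L x"
    unfolding sigma_weight_def
  proof (rule cInf_greatest)
    \<comment> \<open>The infimum of an empty set of reals would be a default value;
      \<open>A = {}\<close> is always an admissible competitor.\<close>
    have "w ({} - L) \<le> w (L - {})" using w by (simp add: set_weight_def)
    then show "{norm (x - (\<Sum>n\<in>A. smul (a n) (e n))) | A a.
        finite A \<and> w (A - L) \<le> w (L - A)} \<noteq> {}" by blast
  next
    fix r assume "r \<in> {norm (x - (\<Sum>n\<in>A. smul (a n) (e n))) | A a.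
        finite A \<and> w (A - L) \<le> w (L - A)}"
    then obtain A a where r: "r = norm (x - (\<Sum>n\<in>A. smul (a n) (e n)))"
      and A: "finite A" "w (A - L) \<le> w (L - A)" by blast
    have "?n \<le> K * C * r" unfolding r
      by (rule suppression_unconditional_property_A_imp_bound[OF su pA L _ A])
        (use g in \<open>auto simp: greedy_set_def\<close>)
    then show "?n / (K * C) \<le> r" using KC by (simp add: divide_le_eq mult.commute)
  qed
  then show "?n \<le> K * C * sigma_weight smul e w L x"
    using KC by (simp add: divide_le_eq mult.commute)
qed

end

theorem theorem2p3:
  fixes smul :: "'k::real_normed_field \<Rightarrow> 'x::banach \<Rightarrow> 'x"
    and e :: "nat \<Rightarrow> 'x"
    and w :: "nat set \<Rightarrow> ennreal"
  assumes "banach_space_over smul"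
    and "semi_normalized_basis smul e"
    and "set_weight w"
  shows "(\<forall>C. weight_greedy smul e w C \<longrightarrow>
              suppression_unconditional smul e C \<and> weight_property_A smul e w C) \<and>
         (\<forall>K C. suppression_unconditional smul e K \<and> weight_property_A smul e w C \<longrightarrow>
              weight_greedy smul e w (K * C))"
proof -
  interpret banach_space_over smul by fact
  interpret semi_normalized_basis_over smul e by unfold_locales fact
  show ?thesis
    using weight_greedy_imp_suppression_unconditional weight_greedy_imp_property_A
      suppression_unconditional_property_A_imp_weight_greedy assms(3) by blast
qed

end
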